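(* Let $X$ be an arbitrary (possibly infinite) set, $R$ a commutative ring with unit, and $r\colon X\to R$ any function. Then there exists a grassmannian map on $\mathscr{F}(X)$, i.e. a map $\tau\colon\mathscr{F}(X)\times\mathscr{F}(X)\to R$ such that (i) $\tau(\{x\},\{x\}) = r(x)$ for all $x\in X$; (ii) $\tau(\{x\},\{y\}) = -\tau(\{y\},\{x\})$ for all $x,y\in X$ with $x\neq y$; (iii) $\tau(\varnothing,A)=\tau(A,\varnothing)=1$ for all $A\in\mathscr{F}(X)$; (iv) $\tau(A,B)\,\tau(A\bigtriangleup B,C)=\tau(A,B\bigtriangleup C)\,\tau(B,C)$ for all $A,B,C\in\mathscr{F}(X)$; (v) $\tau(A,B)\in\{-1,1\}$ whenever $A\cap B=\varnothing$.
   Context: $\mathscr{F}(X)$ denotes the set of all finite subsets of $X$, and $A\bigtriangleup B := (A\cup B)\smallsetminus(A\cap B)$ is the symmetric difference. The axiom of choice is assumed. *)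

theory Defs
  imports "HOL-Algebra.Ring"
begin

end

theory Submission
  imports Defs
begin

text \<open>
  Order \<open>X\<close> linearly and set \<open>\<tau>(A, B) = (-1)\<^sup>n \<Prod>\<^sub>x\<^sub>\<in>\<^sub>A\<^sub>\<inter>\<^sub>B r(x)\<close>, where \<open>n\<close> counts the
  pairs \<open>(a, b) \<in> A \<times> B\<close> with \<open>a > b\<close>; these are the structure constants of the basis of monomials
  in the Clifford algebra of a diagonal quadratic form. The parity of \<open>n\<close> is additive for symmetric differences
  in each argument, so both sides of the associativity law carry the sign of
  \<open>n(A, B) + n(A, C) + n(B, C)\<close>, and on both sides the product of \<open>r\<close> runs over the elements lying in
  at least two of \<open>A\<close>, \<open>B\<close>, \<open>C\<close>.
\<close>

text \<open>The intersection is counted once in \<open>A\<close> and once in \<open>B\<close>, so it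
  cancels modulo 2.\<close>

lemma even_card_sym_diff:
  assumes "finite A" "finite B"
  shows "even (card (sym_diff A B)) \<longleftrightarrow> (even (card A) \<longleftrightarrow> even (card B))"
proof -
  have "card (sym_diff A B) = card (A - B) + card (B - A)"
    using assms by (intro card_Un_disjoint) auto
  moreover have "card A = card (A - B) + card (A \<inter> B)" "card B = card (B - A) + card (A \<inter> B)"
    using assms by (simp_all add: card_Diff_subset_Int Int_commute card_mono)
  ultimately show ?thesis by auto
qed

text \<open>Choice enters here, via the strict part of a well-order. The one equivalence packs
  irreflexivity (take \<open>x = y\<close>) together with trichotomy.\<close>

lemma exists_strict_linear_order: "\<exists>D :: 'a rel. \<forall>x y. (x, y) \<in> D \<longleftrightarrow> x \<noteq> y \<and> (y, x) \<notin> D"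
proof -
  obtain L :: "'a rel" where "well_order_on UNIV L"
    using well_order_on by blast
  then have "\<forall>x y. (x, y) \<in> L - Id \<longleftrightarrow> x \<noteq> y \<and> (y, x) \<notin> L - Id"
    unfolding well_order_on_def linear_order_on_def partial_order_on_def total_on_def antisym_def
    by blast
  then show ?thesis by blast
qed

context cring
begin

definition parity_sign :: "nat \<Rightarrow> 'a"
  where "parity_sign n = (if even n then \<one> else \<ominus> \<one>)"

lemma parity_sign_closed [simp]: "parity_sign n \<in> carrier R"
  by (simp add: parity_sign_def)

lemma parity_sign_mult:
  "parity_sign m \<otimes> parity_sign n = parity_sign (m + n)"
  by (auto simp: parity_sign_def l_minus r_minus)

text \<open>\<open>D\<close> is read as \<open>>\<close>, so the sign counts inversions. It stays an
  arbitrary relation: order properties enter only through the laws on singletons.\<close>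

definition clifford_map :: "'i rel \<Rightarrow> ('i \<Rightarrow> 'a) \<Rightarrow> 'i set \<times> 'i set \<Rightarrow> 'a"
  where "clifford_map D r = (\<lambda>(A, B). parity_sign (card (A \<times> B \<inter> D)) \<otimes> finprod R r (A \<inter> B))"

lemma clifford_map_closed:
  assumes "r \<in> A \<inter> B \<rightarrow> carrier R"
  shows "clifford_map D r (A, B) \<in> carrier R"
  using assms by (simp add: clifford_map_def)

lemma parity_sign_cocycle:
  assumes "finite A" "finite B" "finite C"
  shows "parity_sign (card (A \<times> B \<inter> D)) \<otimes> parity_sign (card (sym_diff A B \<times> C \<inter> D))
       = parity_sign (card (A \<times> sym_diff B C \<inter> D)) \<otimes> parity_sign (card (B \<times> C \<inter> D))"
proof -
  \<comment> \<open>These identities make the inversion count additive modulo 2 in each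
    argument.\<close>
  have "sym_diff A B \<times> C \<inter> D = sym_diff (A \<times> C \<inter> D) (B \<times> C \<inter> D)"
    "A \<times> sym_diff B C \<inter> D = sym_diff (A \<times> B \<inter> D) (A \<times> C \<inter> D)"
    by auto
  then have "even (card (sym_diff A B \<times> C \<inter> D)) \<longleftrightarrow>
      (even (card (A \<times> C \<inter> D)) \<longleftrightarrow> even (card (B \<times> C \<inter> D)))"
    "even (card (A \<times> sym_diff B C \<inter> D)) \<longleftrightarrow>
      (even (card (A \<times> B \<inter> D)) \<longleftrightarrow> even (card (A \<times> C \<inter> D)))"
    using assms by (simp_all only: even_card_sym_diff finite_Int finite_cartesian_product simp_thms)
  then show ?thesis
    unfolding parity_sign_mult by (auto simp: parity_sign_def)
qed

lemma finprod_cocycle: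
  assumes "finite A" "finite B" "finite C" and r: "r \<in> A \<union> B \<union> C \<rightarrow> carrier R"
  shows "finprod R r (A \<inter> B) \<otimes> finprod R r (sym_diff A B \<inter> C)
       = finprod R r (A \<inter> sym_diff B C) \<otimes> finprod R r (B \<inter> C)"
proof -
  \<comment> \<open>Both products run over disjoint sets with the same union, the elements in at
    least two of \<open>A\<close>, \<open>B\<close>, \<open>C\<close>, so each factor
    \<open>r x\<close> occurs exactly once.\<close>
  have "finprod R r (A \<inter> B) \<otimes> finprod R r (sym_diff A B \<inter> C)
      = finprod R r (A \<inter> B \<union> sym_diff A B \<inter> C)"
    using assms by (intro finprod_Un_disjoint [symmetric]) auto
  also have "A \<inter> B \<union> sym_diff A B \<inter> C = A \<inter> sym_diff B C \<union> B \<inter> C"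
    by auto
  also have "finprod R r \<dots> = finprod R r (A \<inter> sym_diff B C) \<otimes> finprod R r (B \<inter> C)"
    using assms by (intro finprod_Un_disjoint) auto
  finally show ?thesis .
qed

lemma clifford_map_cocycle:
  assumes "finite A" "finite B" "finite C" and r: "r \<in> A \<union> B \<union> C \<rightarrow> carrier R"
  shows "clifford_map D r (A, B) \<otimes> clifford_map D r (sym_diff A B, C)
       = clifford_map D r (A, sym_diff B C) \<otimes> clifford_map D r (B, C)"
proof -
  have interchange: "(a \<otimes> b) \<otimes> (c \<otimes> d) = (a \<otimes> c) \<otimes> (b \<otimes> d)"
    if "a \<in> carrier R" "b \<in> carrier R" "c \<in> carrier R" "d \<in> carrier R" for a b c d
    using that by (simp add: m_ac)
  have closed: "finprod R r S \<in> carrier R" if "S \<subseteq> A \<union> B \<union> C" for S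
    using that r by (intro finprod_closed) auto
  have "finprod R r (A \<inter> B) \<in> carrier R" "finprod R r (sym_diff A B \<inter> C) \<in> carrier R"
    "finprod R r (A \<inter> sym_diff B C) \<in> carrier R" "finprod R r (B \<inter> C) \<in> carrier R"
    by (rule closed, blast)+
  \<comment> \<open>Facts 1 to 4 concern the products of \<open>r\<close>, fact 5 the signs. They
    instantiate \<open>interchange\<close>, which gathers signs and products separately.\<close>
  note closed = this parity_sign_closed
  show ?thesis
    unfolding clifford_map_def prod.case
      interchange [OF closed(5,1,5,2)] interchange [OF closed(5,3,5,4)]
    by (simp only: parity_sign_cocycle [OF assms(1-3)] finprod_cocycle [OF assms])
qed

lemma clifford_map_singleton:
  assumes "(x, x) \<notin> D" "r x \<in> carrier R"
  shows "clifford_map D r ({x}, {x}) = r x"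
  using assms by (simp add: clifford_map_def parity_sign_def)

lemma clifford_map_disjoint:
  assumes "A \<inter> B = {}"
  shows "clifford_map D r (A, B) = parity_sign (card (A \<times> B \<inter> D))"
  using assms by (simp add: clifford_map_def)

text \<open>Exactly one of the two orders of \<open>x\<close> and \<open>y\<close> is an inversion,
  so exactly one of the two values is \<open>\<ominus> \<one>\<close>.\<close>

lemma clifford_map_singletons_antisym:
  assumes "x \<noteq> y" "(x, y) \<in> D \<longleftrightarrow> (y, x) \<notin> D"
  shows "clifford_map D r ({x}, {y}) = \<ominus> clifford_map D r ({y}, {x})"
  using assms by (auto simp: clifford_map_disjoint parity_sign_def)

end

theorem theorem2p20:
  fixes X :: "'a set" and R :: "('r, 'm) ring_scheme" (structure) and r :: "'a \<Rightarrow> 'r"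
  assumes "cring R"
    and "r \<in> X \<rightarrow> carrier R"
  shows "\<exists>\<tau> \<in> Fpow X \<times> Fpow X \<rightarrow> carrier R.
      (\<forall>x \<in> X. \<tau> ({x}, {x}) = r x) \<and>
      (\<forall>x \<in> X. \<forall>y \<in> X. x \<noteq> y \<longrightarrow> \<tau> ({x}, {y}) = \<ominus> \<tau> ({y}, {x})) \<and>
      (\<forall>A \<in> Fpow X. \<tau> ({}, A) = \<one> \<and> \<tau> (A, {}) = \<one>) \<and>
      (\<forall>A \<in> Fpow X. \<forall>B \<in> Fpow X. \<forall>C \<in> Fpow X.
         \<tau> (A, B) \<otimes> \<tau> (sym_diff A B, C) = \<tau> (A, sym_diff B C) \<otimes> \<tau> (B, C)) \<and>
      (\<forall>A \<in> Fpow X. \<forall>B \<in> Fpow X. A \<inter> B = {} \<longrightarrow> \<tau> (A, B) \<in> {\<ominus> \<one>, \<one>})"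
proof -
  interpret cring R by fact
  obtain D :: "'a rel" where D: "\<And>x y. (x, y) \<in> D \<longleftrightarrow> x \<noteq> y \<and> (y, x) \<notin> D"
    using exists_strict_linear_order by metis
  have r: "r \<in> A \<rightarrow> carrier R" if "A \<subseteq> X" for A
    using assms(2) that by auto
  show ?thesis
  proof (intro bexI [of _ "clifford_map D r"] conjI ballI impI)
    show "clifford_map D r \<in> Fpow X \<times> Fpow X \<rightarrow> carrier R"
      by (auto simp: Fpow_def intro!: clifford_map_closed r)
  next
    fix x assume "x \<in> X"
    \<comment> \<open>For equal arguments \<open>D\<close> reduces to
      \<open>(x, x) \<notin> D\<close>, hence the sign is \<open>\<one>\<close>.\<close>
    then show "clifford_map D r ({x}, {x}) = r x"
      using D [of x x] assms(2) by (intro clifford_map_singleton) auto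
  next
    fix x y :: 'a assume "x \<noteq> y"
    then show "clifford_map D r ({x}, {y}) = \<ominus> clifford_map D r ({y}, {x})"
      using D [of x y] by (intro clifford_map_singletons_antisym) auto
  next
    fix A B C assume "A \<in> Fpow X" "B \<in> Fpow X" "C \<in> Fpow X"
    then show "clifford_map D r (A, B) \<otimes> clifford_map D r (sym_diff A B, C)
        = clifford_map D r (A, sym_diff B C) \<otimes> clifford_map D r (B, C)"
      by (intro clifford_map_cocycle r) (auto simp: Fpow_def)
  \<comment> \<open>The laws for the empty set and for disjoint sets remain. There the value is a
    bare sign, and an empty argument leaves no pair to count.\<close>
  qed (auto simp: clifford_map_disjoint parity_sign_def)
qed

end
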